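(* For any integer $n\geq 3$, the dihedral group $D_{2n}$ of order $2n$ is good.
   Context: A finite conjugacy class $C$ of a group $G$ is good in $G$ if for every $c\in C$ there is $z\in C$ such that $\langle c\rangle\cap C_G(z)\leq Z(\langle C\rangle)$, where $\langle C\rangle$ is the subgroup of $G$ generated by $C$, $C_G(z)$ is the centralizer of $z$ in $G$, and $Z(\cdot)$ denotes the center. A group $G$ is good if all of its finite conjugacy classes are good in $G$. $D_{2n}$ is the group $\langle s,o\mid s^2=o^n=1,\ sos^{-1}=o^{-1}\rangle$. *)

theory Defs
  imports "HOL-Algebra.Algebra"
begin

section \<open>Good conjugacy classes and good groups\<close>

definition conjugacy_class :: "('a, 'b) monoid_scheme \<Rightarrow> 'a \<Rightarrow> 'a set"
  where "conjugacy_class G x = {g \<otimes>\<^bsub>G\<^esub> x \<otimes>\<^bsub>G\<^esub> inv\<^bsub>G\<^esub> g |g. g \<in> carrier G}"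

definition conjugacy_classes :: "('a, 'b) monoid_scheme \<Rightarrow> 'a set set"
  where "conjugacy_classes G = conjugacy_class G ` carrier G"

definition centralizer :: "('a, 'b) monoid_scheme \<Rightarrow> 'a \<Rightarrow> 'a set"
  where "centralizer G z = {g \<in> carrier G. g \<otimes>\<^bsub>G\<^esub> z = z \<otimes>\<^bsub>G\<^esub> g}"

definition center :: "('a, 'b) monoid_scheme \<Rightarrow> 'a set"
  where "center G = {z \<in> carrier G. \<forall>g \<in> carrier G. z \<otimes>\<^bsub>G\<^esub> g = g \<otimes>\<^bsub>G\<^esub> z}"

definition good_class :: "('a, 'b) monoid_scheme \<Rightarrow> 'a set \<Rightarrow> bool"
  where "good_class G C \<longleftrightarrow>
    C \<in> conjugacy_classes G \<and> finite C \<and>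
    (\<forall>c \<in> C. \<exists>z \<in> C. generate G {c} \<inter> centralizer G z \<subseteq> center (subgroup_generated G C))"

definition good_group :: "('a, 'b) monoid_scheme \<Rightarrow> bool"
  where "good_group G \<longleftrightarrow>
    group G \<and> (\<forall>C \<in> conjugacy_classes G. finite C \<longrightarrow> good_class G C)"


section \<open>Groups given by generators and relations\<close>

datatype 'g letter = Gen 'g | Gen_inv 'g

type_synonym 'g word = "'g letter list"

text \<open>The least congruence on the free monoid over the generators and their formal inverses
  that identifies the two sides of every relation in \<open>R\<close> and makes \<open>Gen x\<close> and \<open>Gen_inv x\<close>
  mutually inverse. The quotient is the group presented by \<open>R\<close> on all elements
  of the type \<open>'g\<close>.\<close>

inductive_set word_cong :: "('g word \<times> 'g word) set \<Rightarrow> ('g word \<times> 'g word) set"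
  for R :: "('g word \<times> 'g word) set"
where
  relation: "(u, v) \<in> R \<Longrightarrow> (u, v) \<in> word_cong R"
| cancel_right: "([Gen x, Gen_inv x], []) \<in> word_cong R"
| cancel_left: "([Gen_inv x, Gen x], []) \<in> word_cong R"
| refl: "(u, u) \<in> word_cong R"
| sym: "(u, v) \<in> word_cong R \<Longrightarrow> (v, u) \<in> word_cong R"
| trans: "(u, v) \<in> word_cong R \<Longrightarrow> (v, w) \<in> word_cong R \<Longrightarrow> (u, w) \<in> word_cong R"
| append: "(u, v) \<in> word_cong R \<Longrightarrow> (u', v') \<in> word_cong R \<Longrightarrow> (u @ u', v @ v') \<in> word_cong R"

definition presented_group :: "('g word \<times> 'g word) set \<Rightarrow> 'g word set monoid"
  where "presented_group R =
    \<lparr>carrier = UNIV // word_cong R,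
     monoid.mult = (\<lambda>A B. \<Union>u \<in> A. \<Union>v \<in> B. word_cong R `` {u @ v}),
     one = word_cong R `` {[]}\<rparr>"

lemma equiv_word_cong: "equiv UNIV (word_cong R)"
  by (intro equivI refl_onI symI transI) (auto intro: word_cong.refl word_cong.sym word_cong.trans)

lemma presented_group_mult:
  "word_cong R `` {u} \<otimes>\<^bsub>presented_group R\<^esub> word_cong R `` {v} = word_cong R `` {u @ v}"
proof -
  have "congruent2 (word_cong R) (word_cong R) (\<lambda>u v. word_cong R `` {u @ v})"
    by (intro congruent2I' equiv_class_eq[OF equiv_word_cong] word_cong.append)
  from UN_equiv_class2[OF equiv_word_cong equiv_word_cong this] show ?thesis
    by (simp add: presented_group_def)
qed

primrec inv_letter :: "'g letter \<Rightarrow> 'g letter" where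
  "inv_letter (Gen x) = Gen_inv x"
| "inv_letter (Gen_inv x) = Gen x"

lemma word_cong_left_inverse: "(rev (map inv_letter u) @ u, []) \<in> word_cong R"
proof (induction u)
  case Nil
  show ?case by (simp add: word_cong.refl)
next
  case (Cons a u)
  have "([inv_letter a, a], []) \<in> word_cong R"
    by (cases a) (simp_all add: word_cong.cancel_left word_cong.cancel_right)
  then have "(rev (map inv_letter u) @ ([inv_letter a, a] @ u),
      rev (map inv_letter u) @ ([] @ u)) \<in> word_cong R"
    by (intro word_cong.append word_cong.refl)
  with Cons.IH show ?case
    using word_cong.trans by fastforce
qed

lemma group_presented_group: "group (presented_group R)"
proof -
  have carr: "carrier (presented_group R) = (\<lambda>u. word_cong R `` {u}) ` UNIV"
    by (auto simp: presented_group_def quotient_def)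
  have one: "\<one>\<^bsub>presented_group R\<^esub> = word_cong R `` {[]}"
    by (simp add: presented_group_def)
  show ?thesis
  proof (rule groupI)
    fix x assume "x \<in> carrier (presented_group R)"
    then obtain u where x: "x = word_cong R `` {u}" by (auto simp: carr)
    have "word_cong R `` {rev (map inv_letter u)} \<otimes>\<^bsub>presented_group R\<^esub> x = \<one>\<^bsub>presented_group R\<^esub>"
      unfolding x presented_group_mult one
      by (rule equiv_class_eq[OF equiv_word_cong word_cong_left_inverse])
    then show "\<exists>y \<in> carrier (presented_group R). y \<otimes>\<^bsub>presented_group R\<^esub> x = \<one>\<^bsub>presented_group R\<^esub>"
      by (auto simp: carr)
  qed (auto simp: carr one presented_group_mult)
qed


section \<open>Dihedral groups\<close>

datatype dihedral_gen = Reflection | Rotation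

text \<open>The presentation \<open>\<langle>s, o | s\<^sup>2 = o\<^sup>n = 1, s o s\<^sup>-\<^sup>1 = o\<^sup>-\<^sup>1\<rangle>\<close> with \<open>s = Reflection\<close> and
  \<open>o = Rotation\<close>. The argument is \<open>n\<close>, not the group order \<open>2 n\<close>.\<close>

definition dihedral_relations :: "nat \<Rightarrow> (dihedral_gen word \<times> dihedral_gen word) set"
  where "dihedral_relations n =
    {([Gen Reflection, Gen Reflection], []),
     (replicate n (Gen Rotation), []),
     ([Gen Reflection, Gen Rotation, Gen_inv Reflection], [Gen_inv Rotation])}"

definition dihedral_group :: "nat \<Rightarrow> dihedral_gen word set monoid"
  where "dihedral_group n = presented_group (dihedral_relations n)"

lemma group_dihedral_group: "group (dihedral_group n)"
  unfolding dihedral_group_def by (rule group_presented_group)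

text \<open>The presented group has order \<open>2 n\<close>: \<open>(b, k)\<close> stands for \<open>s\<^sup>b o\<^sup>k\<close>, and letters act
  on these pairs by left multiplication.\<close>

fun letter_act :: "dihedral_gen letter \<Rightarrow> bool \<times> int \<Rightarrow> bool \<times> int" where
  "letter_act (Gen Reflection) (b, k) = (\<not> b, k)"
| "letter_act (Gen_inv Reflection) (b, k) = (\<not> b, k)"
| "letter_act (Gen Rotation) (b, k) = (b, if b then k - 1 else k + 1)"
| "letter_act (Gen_inv Rotation) (b, k) = (b, if b then k + 1 else k - 1)"

definition normal_word :: "nat \<Rightarrow> bool \<times> int \<Rightarrow> dihedral_gen word"
  where "normal_word n p = (if fst p then [Gen Reflection] else []) @
    replicate (nat (snd p mod int n)) (Gen Rotation)"

lemma letter_act_shift: "letter_act a (b, k + d) = (fst (letter_act a (b, k)), snd (letter_act a (b, k)) + d)"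
  by (cases "(a, (b, k))" rule: letter_act.cases) auto

lemma fold_shift: "foldr letter_act w (b, k + d) =
    (fst (foldr letter_act w (b, k)), snd (foldr letter_act w (b, k)) + d)"
proof (induction w)
  case (Cons a w)
  then show ?case
    by (metis foldr_Cons comp_apply letter_act_shift prod.collapse)
qed simp

lemma funpow_rotation: "(letter_act (Gen Rotation) ^^ m) (b, k) =
    (b, if b then k - int m else k + int m)"
  by (induction m) auto

lemma word_cong_dihedral_invariant:
  assumes "(u, v) \<in> word_cong (dihedral_relations n)"
  shows "fst (foldr letter_act u (b, k)) = fst (foldr letter_act v (b, k)) \<and>
    snd (foldr letter_act u (b, k)) mod int n = snd (foldr letter_act v (b, k)) mod int n"
  using assms
proof (induction arbitrary: b k rule: word_cong.induct)
  case (relation u v)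
  then show ?case
    by (auto simp: dihedral_relations_def funpow_rotation)
next
  case (cancel_right x)
  show ?case by (cases x; cases b) auto
next
  case (cancel_left x)
  show ?case by (cases x; cases b) auto
next
  case (append u v u' v')
  obtain b1 k1 where 1: "foldr letter_act u' (b, k) = (b1, k1)" by fastforce
  obtain b2 k2 where 2: "foldr letter_act v' (b, k) = (b2, k2)" by fastforce
  have b2: "b2 = b1" and k: "k1 mod int n = k2 mod int n"
    using append.IH(2)[of b k] by (simp_all only: 1 2 fst_conv snd_conv)
  from k obtain d where k2: "k2 = k1 + int n * d"
    by (rule mod_eqE)
  have "foldr letter_act (v @ v') (b, k) =
      (fst (foldr letter_act v (b1, k1)), snd (foldr letter_act v (b1, k1)) + int n * d)"
    using 2 fold_shift[of v b1 k1] by (simp add: b2 k2)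
  then show ?case
    using append.IH(1)[of b1 k1] 1 by simp
qed auto

context
  fixes n :: nat and cong (infix "\<doteq>" 50)
  assumes n: "n > 0"
  defines "u \<doteq> v \<equiv> (u, v) \<in> word_cong (dihedral_relations n)"
begin

private lemma cong_trans [trans]: "u \<doteq> v \<Longrightarrow> v \<doteq> w \<Longrightarrow> u \<doteq> w"
  unfolding cong_def by (rule word_cong.trans)

private lemma cong_refl: "u \<doteq> u"
  unfolding cong_def by (rule word_cong.refl)

private lemma cong_sym: "u \<doteq> v \<Longrightarrow> v \<doteq> u"
  unfolding cong_def by (rule word_cong.sym)

private lemma cong_context: "u \<doteq> v \<Longrightarrow> x @ u @ y \<doteq> x @ v @ y"
  unfolding cong_def by (intro word_cong.append word_cong.refl)

private lemma cong_basic: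
  "[Gen g, Gen_inv g] \<doteq> []" "[Gen_inv g, Gen g] \<doteq> []"
  "[Gen Reflection, Gen Reflection] \<doteq> []"
  "replicate n (Gen Rotation) \<doteq> []"
  "[Gen Reflection, Gen Rotation, Gen_inv Reflection] \<doteq> [Gen_inv Rotation]"
  unfolding cong_def
  by (rule word_cong.cancel_right word_cong.cancel_left word_cong.relation,
      (simp add: dihedral_relations_def)?)+

private lemma reflection_inv: "[Gen_inv Reflection] \<doteq> [Gen Reflection]"
proof -
  have "[Gen_inv Reflection] \<doteq> [Gen_inv Reflection] @ [Gen Reflection, Gen Reflection] @ []"
    using cong_context[OF cong_sym[OF cong_basic(3)], of "[Gen_inv Reflection]" "[]"] by simp
  also have "\<dots> \<doteq> [Gen Reflection]"
    using cong_context[OF cong_basic(2)[of Reflection], of "[]" "[Gen Reflection]"] by simp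
  finally show ?thesis .
qed

private lemma swap_inv: "[Gen_inv Rotation, Gen Reflection] \<doteq> [Gen Reflection, Gen Rotation]"
proof -
  have "[Gen_inv Rotation, Gen Reflection] \<doteq>
      [Gen Reflection, Gen Rotation, Gen_inv Reflection, Gen Reflection]"
    using cong_context[OF cong_sym[OF cong_basic(5)], of "[]" "[Gen Reflection]"] by simp
  also have "\<dots> \<doteq> [Gen Reflection, Gen Rotation]"
    using cong_context[OF cong_basic(2)[of Reflection], of "[Gen Reflection, Gen Rotation]" "[]"]
    by simp
  finally show ?thesis .
qed

private lemma swap: "[Gen Rotation, Gen Reflection] \<doteq> [Gen Reflection, Gen_inv Rotation]"
proof -
  have "[Gen Rotation, Gen Reflection] \<doteq>
      [Gen Rotation] @ [Gen Reflection, Gen Rotation] @ [Gen_inv Rotation]"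
    using cong_context[OF cong_sym[OF cong_basic(1)[of Rotation]],
        of "[Gen Rotation, Gen Reflection]" "[]"] by simp
  also have "\<dots> \<doteq> [Gen Rotation] @ [Gen_inv Rotation, Gen Reflection] @ [Gen_inv Rotation]"
    by (rule cong_context[OF cong_sym[OF swap_inv]])
  also have "\<dots> \<doteq> [Gen Reflection, Gen_inv Rotation]"
    using cong_context[OF cong_basic(1)[of Rotation], of "[]" "[Gen Reflection, Gen_inv Rotation]"]
    by simp
  finally show ?thesis .
qed

private lemma rotation_step:
  "Gen Rotation # normal_word n (False, k) \<doteq> normal_word n (False, k + 1)"
proof -
  have *: "nat (k mod int n) < n" using n by (simp add: nat_less_iff)
  show ?thesis
  proof (cases "Suc (nat (k mod int n)) = n")
    case True
    moreover have "0 \<le> k mod int n" using n by simp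
    ultimately have "k mod int n + 1 = int n" by linarith
    then have "(k + 1) mod int n = 0"
      using mod_add_left_eq[of k "int n" 1] by simp
    then show ?thesis
      using True cong_basic(4) by (simp add: normal_word_def flip: replicate_Suc)
  next
    case False
    with * have "k mod int n + 1 < int n" by linarith
    then have "(k + 1) mod int n = k mod int n + 1"
      using n mod_add_left_eq[of k "int n" 1] by simp
    then show ?thesis
      using n by (simp add: normal_word_def nat_add_distrib cong_refl flip: replicate_Suc)
  qed
qed

private lemma rotation_inv_step:
  "Gen_inv Rotation # normal_word n (False, k) \<doteq> normal_word n (False, k - 1)"
proof -
  have "Gen_inv Rotation # normal_word n (False, k) \<doteq>
      Gen_inv Rotation # Gen Rotation # normal_word n (False, k - 1)"
    using cong_context[OF cong_sym[OF rotation_step[of "k - 1"]], of "[Gen_inv Rotation]" "[]"]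
    by simp
  also have "\<dots> \<doteq> normal_word n (False, k - 1)"
    using cong_context[OF cong_basic(2)[of Rotation], of "[]"] by simp
  finally show ?thesis .
qed

private lemma normal_True: "normal_word n (True, k) = Gen Reflection # normal_word n (False, k)"
  by (simp add: normal_word_def)

private lemma letter_step: "a # normal_word n p \<doteq> normal_word n (letter_act a p)"
proof -
  obtain b k where p: "p = (b, k)" by fastforce
  have refl_step: "Gen Reflection # normal_word n p \<doteq> normal_word n (\<not> b, k)"
    using cong_context[OF cong_basic(3), of "[]"] by (cases b) (auto simp: p normal_True cong_refl)
  have pull: "x # normal_word n (True, k) \<doteq> normal_word n (True, j)"
    if "[x, Gen Reflection] \<doteq> [Gen Reflection, y]"
      "y # normal_word n (False, k) \<doteq> normal_word n (False, j)" for x y j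
    using cong_trans[OF cong_context[OF that(1), of "[]" "normal_word n (False, k)"]]
      cong_context[OF that(2), of "[Gen Reflection]" "[]"] by (simp add: normal_True)
  show ?thesis
  proof (cases "(a, p)" rule: letter_act.cases)
    case 1
    then show ?thesis using refl_step p by simp
  next
    case 2
    have "Gen_inv Reflection # normal_word n p \<doteq> Gen Reflection # normal_word n p"
      using cong_context[OF reflection_inv, of "[]" "normal_word n p"] by simp
    from cong_trans[OF this refl_step] show ?thesis using 2 p by simp
  next
    case 3
    then show ?thesis
      using p pull[OF swap rotation_inv_step] rotation_step by (cases b) simp_all
  next
    case 4
    then show ?thesis
      using p pull[OF swap_inv rotation_step] rotation_inv_step by (cases b) simp_all
  qed
qed

private lemma word_normal: "w \<doteq> normal_word n (foldr letter_act w (False, 0))"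
proof (induction w)
  case Nil
  show ?case using cong_refl[of "[]"] by (simp add: normal_word_def)
next
  case (Cons a w)
  have "a # w \<doteq> a # normal_word n (foldr letter_act w (False, 0))"
    using cong_context[OF Cons.IH, of "[a]" "[]"] by simp
  from cong_trans[OF this letter_step] show ?case by simp
qed

lemma order_dihedral_group: "order (dihedral_group n) = 2 * n"
proof -
  let ?cls = "\<lambda>w. word_cong (dihedral_relations n) `` {w}"
  let ?P = "(UNIV :: bool set) \<times> {0..<int n}"
  have carr: "carrier (dihedral_group n) = range ?cls"
    by (auto simp: dihedral_group_def presented_group_def quotient_def)
  have cls_eq: "?cls u = ?cls v \<longleftrightarrow> u \<doteq> v" for u v
    unfolding cong_def by (rule eq_equiv_class_iff[OF equiv_word_cong]) auto
  have fold_normal: "foldr letter_act (normal_word n p) (False, 0) = p" if "p \<in> ?P" for p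
    using that by (cases p; cases "fst p") (simp_all add: normal_word_def funpow_rotation)
  have "bij_betw (\<lambda>p. ?cls (normal_word n p)) ?P (carrier (dihedral_group n))"
    unfolding bij_betw_def
  proof
    show "inj_on (\<lambda>p. ?cls (normal_word n p)) ?P"
    proof (rule inj_onI)
      fix p q assume pq: "p \<in> ?P" "q \<in> ?P" "?cls (normal_word n p) = ?cls (normal_word n q)"
      then have "normal_word n p \<doteq> normal_word n q" by (simp add: cls_eq)
      then show "p = q"
        using word_cong_dihedral_invariant[of "normal_word n p" "normal_word n q" n False 0] pq
        by (auto simp: cong_def fold_normal)
    qed
    have "\<exists>p \<in> ?P. ?cls w = ?cls (normal_word n p)" for w
    proof -
      obtain b k where bk: "foldr letter_act w (False, 0) = (b, k)" by fastforce
      have "normal_word n (b, k) = normal_word n (b, k mod int n)"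
        by (simp add: normal_word_def)
      then have "?cls w = ?cls (normal_word n (b, k mod int n))"
        using word_normal[of w] bk by (simp only: cls_eq)
      moreover have "(b, k mod int n) \<in> ?P" using n by simp
      ultimately show ?thesis by blast
    qed
    then show "(\<lambda>p. ?cls (normal_word n p)) ` ?P = carrier (dihedral_group n)"
      unfolding carr by blast
  qed
  then have "order (dihedral_group n) = card ?P"
    unfolding order_def by (rule bij_betw_same_card[symmetric])
  then show ?thesis by (simp add: card_cartesian_product)
qed

end

end

(* An element c of a class C either commutes with all of C, and then the subgroup generated by c is
   central in the one generated by C, or c fails to commute with some z in C. In the second case
   c = c^-1 suffices, since then the subgroup generated by c meets the centralizer of z trivially.
   In a dihedral group the classes of rotations are commutative and the reflections are
   involutions. *)

theory Submission
  imports Defs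
begin

context group
begin

section \<open>Centralizers and subgroups with commuting generators\<close>

lemma subgroup_centralizer:
  assumes "z \<in> carrier G"
  shows "subgroup (centralizer G z) G"
proof (rule subgroupI)
  show "centralizer G z \<noteq> {}"
    using assms by (auto simp: centralizer_def)
next
  fix g assume "g \<in> centralizer G z"
  then have g: "g \<in> carrier G" "g \<otimes> z = z \<otimes> g" by (auto simp: centralizer_def)
  have "inv g \<otimes> z = inv g \<otimes> (z \<otimes> g) \<otimes> inv g"
    using assms g(1) by (simp add: m_assoc)
  also have "z \<otimes> g = g \<otimes> z" by (rule g(2)[symmetric])
  also have "inv g \<otimes> (g \<otimes> z) \<otimes> inv g = z \<otimes> inv g"
    using assms g(1) by (simp flip: m_assoc)
  finally show "inv g \<in> centralizer G z"
    using g(1) by (simp add: centralizer_def)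
next
  fix g h assume "g \<in> centralizer G z" "h \<in> centralizer G z"
  then have gh: "g \<in> carrier G" "h \<in> carrier G" "g \<otimes> z = z \<otimes> g" "h \<otimes> z = z \<otimes> h"
    by (auto simp: centralizer_def)
  have "g \<otimes> h \<otimes> z = g \<otimes> (z \<otimes> h)"
    using assms gh(1,2) by (simp add: m_assoc gh(4))
  also have "\<dots> = z \<otimes> (g \<otimes> h)"
    using assms gh(1,2) by (simp add: gh(3) flip: m_assoc)
  finally show "g \<otimes> h \<in> centralizer G z"
    using gh by (simp add: centralizer_def)
qed (auto simp: centralizer_def)

text \<open>A centralizer is a subgroup, so once it contains a generating set it contains the
  generated subgroup. This is applied first to the centralizer of each \<open>y\<close> in
  \<open>T\<close>, then to the centralizer of \<open>g\<close>.\<close>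

lemma generate_commute:
  assumes "S \<subseteq> carrier G" "T \<subseteq> carrier G"
    and comm: "\<And>x y. x \<in> S \<Longrightarrow> y \<in> T \<Longrightarrow> x \<otimes> y = y \<otimes> x"
    and "g \<in> generate G S" "h \<in> generate G T"
  shows "g \<otimes> h = h \<otimes> g"
proof -
  have "S \<subseteq> centralizer G y" if "y \<in> T" for y
    using that assms(1) comm by (auto simp: centralizer_def)
  then have g: "g \<in> centralizer G y" if "y \<in> T" for y
    using that assms(2,4) generate_subgroup_incl subgroup_centralizer by blast
  have "g \<in> carrier G"
    using assms(1,4) generate_in_carrier by blast
  moreover have "T \<subseteq> centralizer G g"
    using g assms(2) by (auto simp: centralizer_def)
  ultimately have "h \<in> centralizer G g"
    using assms(5) generate_subgroup_incl subgroup_centralizer by blast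
  then show ?thesis by (simp add: centralizer_def)
qed

lemma generate_subset_center:
  assumes "C \<subseteq> carrier G" "c \<in> C"
    and "\<And>z. z \<in> C \<Longrightarrow> c \<otimes> z = z \<otimes> c"
  shows "generate G {c} \<subseteq> center (subgroup_generated G C)"
proof
  fix h assume h: "h \<in> generate G {c}"
  have "h \<in> generate G C"
    using h assms(2) mono_generate[of "{c}" C] by blast
  moreover have "h \<otimes> g = g \<otimes> h" if "g \<in> generate G C" for g
    using generate_commute[of "{c}" C h g] assms h that by blast
  \<comment> \<open>The carrier of \<open>subgroup_generated G C\<close> is generated by
    \<open>carrier G \<inter> C\<close>, which is \<open>C\<close> here.\<close>
  ultimately show "h \<in> center (subgroup_generated G C)"
    using assms(1) by (simp add: center_def carrier_subgroup_generated Int_absorb1)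
qed

section \<open>Criteria for good classes and good groups\<close>

lemma generate_involution:
  assumes "c \<in> carrier G" "c \<otimes> c = \<one>"
  shows "generate G {c} \<subseteq> {\<one>, c}"
proof -
  have "inv c = c"
    using assms by (simp add: inv_equality)
  then have "subgroup {\<one>, c} G"
    using assms by (intro subgroupI) auto
  then show ?thesis by (simp add: generate_subgroup_incl)
qed

lemma good_classI:
  assumes "C \<in> conjugacy_classes G" "finite C" "C \<subseteq> carrier G"
    and dich: "\<And>c. c \<in> C \<Longrightarrow> c \<otimes> c = \<one> \<or> (\<forall>z \<in> C. c \<otimes> z = z \<otimes> c)"
  shows "good_class G C"
proof -
  have "\<exists>z \<in> C. generate G {c} \<inter> centralizer G z \<subseteq> center (subgroup_generated G C)"
    if c: "c \<in> C" for c
  proof (cases "\<forall>z \<in> C. c \<otimes> z = z \<otimes> c")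
    case True
    \<comment> \<open>The witness \<open>z\<close> can be \<open>c\<close> itself, since the whole
      of \<open>generate G {c}\<close> is central.\<close>
    then show ?thesis
      using generate_subset_center[of C c] assms(3) c by blast
  next
    case False
    then obtain z where z: "z \<in> C" "c \<otimes> z \<noteq> z \<otimes> c" by blast
    \<comment> \<open>By the dichotomy \<open>c\<close> squares to \<open>\<one>\<close>, so
      \<open>generate G {c}\<close> has no elements besides \<open>\<one>\<close> and
      \<open>c\<close>, and \<open>c\<close> does not centralize \<open>z\<close>.\<close>
    have "generate G {c} \<inter> centralizer G z \<subseteq> {\<one>}"
      using generate_involution[of c] dich[OF c] False z c assms(3)
      by (auto simp: centralizer_def)
    moreover have "\<one> \<in> center (subgroup_generated G C)"
      using assms(3) generate_in_carrier[of C]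
      by (auto simp: center_def carrier_subgroup_generated Int_absorb1 generate.one)
    ultimately show ?thesis using z(1) by blast
  qed
  then show ?thesis
    using assms(1,2) by (simp add: good_class_def)
qed

text \<open>Since \<open>A\<close> is closed under conjugation, the class of an \<open>x\<close> in
  \<open>A\<close> stays inside \<open>A\<close>, where everything commutes. The class of any other
  \<open>x\<close> consists of conjugates of an element with square \<open>\<one>\<close>. Either
  way the dichotomy of \<open>good_classI\<close> holds.\<close>

lemma good_groupI:
  assumes "A \<subseteq> carrier G"
    and comm: "\<And>a b. a \<in> A \<Longrightarrow> b \<in> A \<Longrightarrow> a \<otimes> b = b \<otimes> a"
    and conj: "\<And>g a. g \<in> carrier G \<Longrightarrow> a \<in> A \<Longrightarrow> g \<otimes> a \<otimes> inv g \<in> A"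
    and invol: "\<And>x. x \<in> carrier G \<Longrightarrow> x \<notin> A \<Longrightarrow> x \<otimes> x = \<one>"
  shows "good_group G"
  unfolding good_group_def
proof (intro conjI ballI impI)
  fix C assume C: "C \<in> conjugacy_classes G" "finite C"
  then obtain x where x: "x \<in> carrier G" "C = conjugacy_class G x"
    by (auto simp: conjugacy_classes_def)
  show "good_class G C"
  proof (rule good_classI[OF C])
    show "C \<subseteq> carrier G"
      using x by (auto simp: conjugacy_class_def)
    fix c assume "c \<in> C"
    then obtain g where g: "g \<in> carrier G" "c = g \<otimes> x \<otimes> inv g"
      using x by (auto simp: conjugacy_class_def)
    show "c \<otimes> c = \<one> \<or> (\<forall>z \<in> C. c \<otimes> z = z \<otimes> c)"
    proof (cases "x \<in> A")
      case True
      then have "C \<subseteq> A" using x(2) conj by (auto simp: conjugacy_class_def)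
      then show ?thesis using comm \<open>c \<in> C\<close> by blast
    next
      case False
      \<comment> \<open>Reassociation only, so that \<open>inv g \<otimes> g\<close> appears in the
        middle and the next step can cancel it.\<close>
      have "c \<otimes> c = g \<otimes> (x \<otimes> (inv g \<otimes> g) \<otimes> x) \<otimes> inv g"
        using g x(1) by (simp only: m_assoc m_closed inv_closed)
      also have "\<dots> = \<one>"
        using g x(1) invol[OF x(1) False] by simp
      finally show ?thesis ..
    qed
  qed
qed (rule is_group)

section \<open>Groups generated by a reflection and a rotation\<close>

lemma good_group_dihedral:
  assumes s: "s \<in> carrier G" and r: "r \<in> carrier G"
    and s2: "s \<otimes> s = \<one>" and srs: "s \<otimes> r \<otimes> inv s = inv r"
    and gen: "carrier G \<subseteq> generate G {s, r}"
  shows "good_group G"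
proof -
  define A where "A = generate G {r}"
  have subA: "subgroup A G"
    unfolding A_def using r by (intro generate_is_subgroup) simp
  interpret A: subgroup A G by (rule subA)
  have inv_s: "inv s = s"
    using s s2 by (simp add: inv_equality)
  \<comment> \<open>The relation \<open>s \<otimes> s = \<one>\<close> in the form that fires inside
    products nested to the right by \<open>m_assoc\<close>.\<close>
  have ss: "s \<otimes> (s \<otimes> x) = x" if "x \<in> carrier G" for x
    using that s s2 by (simp flip: m_assoc)
  have commA: "a \<otimes> b = b \<otimes> a" if "a \<in> A" "b \<in> A" for a b
    using generate_commute[of "{r}" "{r}"] r that unfolding A_def by blast
  \<comment> \<open>Conjugation by \<open>s\<close> inverts the generator \<open>r\<close>. Because
    \<open>A\<close> is abelian, inversion is multiplicative on \<open>A\<close>, so the property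
    passes to products.\<close>
  have sas: "s \<otimes> a \<otimes> s = inv a" if "a \<in> A" for a
    using that unfolding A_def
  proof (induction rule: generate.induct)
    case one
    show ?case using s s2 by simp
  next
    case (incl h)
    then show ?case using srs inv_s by simp
  next
    case (inv h)
    have "inv (s \<otimes> r \<otimes> s) = s \<otimes> inv r \<otimes> s"
      using s r by (simp add: inv_mult_group inv_s m_assoc)
    then show ?case using inv srs inv_s by simp
  next
    case (eng h k)
    have A: "h \<in> A" "k \<in> A" using eng.hyps by (simp_all add: A_def)
    then have hk: "h \<in> carrier G" "k \<in> carrier G" by simp_all
    have "s \<otimes> (h \<otimes> k) \<otimes> s = (s \<otimes> h \<otimes> s) \<otimes> (s \<otimes> k \<otimes> s)"
      using hk s by (simp add: m_assoc ss)
    also have "\<dots> = inv (h \<otimes> k)"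
      using eng.IH commA[OF A] hk by (simp add: inv_mult_group[symmetric])
    finally show ?case .
  qed
  \<comment> \<open>The rule for moving \<open>s\<close> to the left of a rotation, at the price of
    inverting the rotation.\<close>
  have as: "a \<otimes> s = s \<otimes> inv a" if "a \<in> A" for a
  proof -
    have "s \<otimes> inv a = s \<otimes> (s \<otimes> a \<otimes> s)"
      by (simp only: sas[OF that])
    also have "\<dots> = a \<otimes> s"
      using s that by (simp add: m_assoc ss)
    finally show ?thesis ..
  qed
  \<comment> \<open>Normal form: the union of \<open>A\<close> and its coset under \<open>s\<close>
    contains the generators and their inverses, and \<open>as\<close> shows that it is closed under
    products.\<close>
  have cover: "x \<in> A \<or> (\<exists>a \<in> A. x = s \<otimes> a)" if "x \<in> carrier G" for x
    using subsetD[OF gen that]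
  proof (induction rule: generate.induct)
    case (incl h)
    have "r \<in> A" by (simp add: A_def generate.incl)
    moreover have "\<exists>a \<in> A. s = s \<otimes> a"
      using s by (intro bexI[of _ \<one>]) simp_all
    ultimately show ?case using incl by auto
  next
    case (inv h)
    have "inv r \<in> A" by (simp add: A_def generate.inv)
    moreover have "\<exists>a \<in> A. inv s = s \<otimes> a"
      using s inv_s by (intro bexI[of _ \<one>]) simp_all
    ultimately show ?case using inv by auto
  next
    case (eng h k)
    have mult_s: "a \<otimes> (s \<otimes> b) = s \<otimes> (inv a \<otimes> b)" if "a \<in> A" "b \<in> A" for a b
    proof -
      have "a \<otimes> (s \<otimes> b) = (a \<otimes> s) \<otimes> b"
        using that s by (simp add: m_assoc)
      also have "\<dots> = s \<otimes> (inv a \<otimes> b)"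
        unfolding as[OF that(1)] using that s by (simp add: m_assoc)
      finally show ?thesis .
    qed
    consider (AA) "h \<in> A" "k \<in> A" | (As) b where "h \<in> A" "b \<in> A" "k = s \<otimes> b"
      | (sA) a where "a \<in> A" "h = s \<otimes> a" "k \<in> A"
      | (s_s) a b where "a \<in> A" "h = s \<otimes> a" "b \<in> A" "k = s \<otimes> b"
      using eng.IH by blast
    then show ?case
    proof cases
      case AA
      then show ?thesis by simp
    next
      case As
      then have "h \<otimes> k = s \<otimes> (inv h \<otimes> b)" by (simp add: mult_s)
      moreover have "inv h \<otimes> b \<in> A" using As by simp
      ultimately show ?thesis by blast
    next
      case sA
      then have "h \<otimes> k = s \<otimes> (a \<otimes> k)" using s by (simp add: m_assoc)
      moreover have "a \<otimes> k \<in> A" using sA by simp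
      ultimately show ?thesis by blast
    next
      case s_s
      \<comment> \<open>Moving the inner \<open>s\<close> to the front inverts \<open>a\<close>, and
        the two copies of \<open>s\<close> cancel, so the product falls back into
        \<open>A\<close>.\<close>
      have "h \<otimes> k = s \<otimes> (a \<otimes> (s \<otimes> b))" using s_s s by (simp add: m_assoc)
      also have "\<dots> = inv a \<otimes> b"
        using s_s(1,3) by (simp add: mult_s ss)
      finally show ?thesis using s_s by simp
    qed
  qed simp
  show ?thesis
  proof (rule good_groupI)
    show "A \<subseteq> carrier G" by (rule A.subset)
    show "a \<otimes> b = b \<otimes> a" if "a \<in> A" "b \<in> A" for a b
      using that by (rule commA)
    show "g \<otimes> a \<otimes> inv g \<in> A" if g: "g \<in> carrier G" and a: "a \<in> A" for g a
    proof (cases "g \<in> A")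
      case True
      then show ?thesis using a by simp
    next
      case False
      then obtain b where b: "b \<in> A" "g = s \<otimes> b" using cover[OF g] by blast
      \<comment> \<open>Conjugation by \<open>g\<close> is conjugation by \<open>b\<close>, which
        preserves \<open>A\<close>, followed by conjugation by \<open>s\<close>, which
        inverts.\<close>
      have "g \<otimes> a \<otimes> inv g = s \<otimes> (b \<otimes> a \<otimes> inv b) \<otimes> s"
        using a b s by (simp add: inv_mult_group inv_s m_assoc)
      also have "\<dots> = inv (b \<otimes> a \<otimes> inv b)"
        using a b by (intro sas) simp
      finally show ?thesis using a b by simp
    qed
    show "x \<otimes> x = \<one>" if x: "x \<in> carrier G" "x \<notin> A" for x
    proof -
      obtain a where a: "a \<in> A" "x = s \<otimes> a" using cover x by blast
      \<comment> \<open>Regrouped so that \<open>sas\<close> makes the bracket \<open>inv a\<close>,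
        which cancels the last factor.\<close>
      have "x \<otimes> x = (s \<otimes> a \<otimes> s) \<otimes> a"
        using a s by (simp add: m_assoc)
      then show ?thesis using a sas by simp
    qed
  qed
qed

end

section \<open>Inverses and generators in presented groups\<close>

lemma presented_group_class_closed: "word_cong R `` {w} \<in> carrier (presented_group R)"
  by (simp add: presented_group_def quotientI)

lemma presented_group_one: "\<one>\<^bsub>presented_group R\<^esub> = word_cong R `` {[]}"
  by (simp add: presented_group_def)

lemma presented_group_class_eq: "(u, v) \<in> word_cong R \<Longrightarrow> word_cong R `` {u} = word_cong R `` {v}"
  by (rule equiv_class_eq[OF equiv_word_cong])

text \<open>The congruence cancels \<open>Gen_inv x\<close> standing before \<open>Gen x\<close>,
  and a left inverse in a group is the inverse. This links the formal inverse letters of a relation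
  to the inverse of the group.\<close>

lemma presented_group_inv_Gen:
  "inv\<^bsub>presented_group R\<^esub> (word_cong R `` {[Gen x]}) = word_cong R `` {[Gen_inv x]}"
proof -
  interpret group "presented_group R" by (rule group_presented_group)
  show ?thesis
    using presented_group_class_eq[OF word_cong.cancel_left, of R x]
    by (intro inv_equality)
      (simp_all add: presented_group_mult presented_group_one presented_group_class_closed)
qed

text \<open>The class of a word is the product of the classes of its letters, each of which is a
  generator or the inverse of one.\<close>

lemma presented_group_generate:
  "carrier (presented_group R) \<subseteq> generate (presented_group R) (range (\<lambda>x. word_cong R `` {[Gen x]}))"
    (is "_ \<subseteq> generate ?G ?X")
proof -
  have letter: "word_cong R `` {[a]} \<in> generate ?G ?X" for a
  proof (cases a)
    case (Gen x)
    then show ?thesis by (auto intro: generate.incl)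
  next
    case (Gen_inv x)
    have "inv\<^bsub>?G\<^esub> (word_cong R `` {[Gen x]}) \<in> generate ?G ?X"
      by (auto intro: generate.inv)
    then show ?thesis using Gen_inv by (simp add: presented_group_inv_Gen)
  qed
  have "word_cong R `` {w} \<in> generate ?G ?X" for w
  proof (induction w)
    case Nil
    show ?case by (metis generate.one presented_group_one)
  next
    case (Cons a w)
    from generate.eng[OF letter[of a] Cons.IH] show ?case
      by (simp add: presented_group_mult)
  qed
  then show ?thesis
    by (auto simp: presented_group_def quotient_def)
qed

theorem theorem5p2:
  fixes n :: nat
  assumes "n \<ge> 3"
  shows "good_group (dihedral_group n)"
proof -
  let ?R = "dihedral_relations n"
  interpret group "dihedral_group n" by (rule group_dihedral_group)
  have univ: "UNIV = {Reflection, Rotation}"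
    by (auto intro: dihedral_gen.exhaust)
  \<comment> \<open>The generator type has exactly two values, so the generating set takes the
    two-element form that \<open>good_group_dihedral\<close> expects.\<close>
  have gens: "range (\<lambda>x. word_cong ?R `` {[Gen x]}) =
      {word_cong ?R `` {[Gen Reflection]}, word_cong ?R `` {[Gen Rotation]}}"
    by (simp add: univ)
  \<comment> \<open>Two defining relations as equalities of classes; splitting words by
    \<open>presented_group_mult\<close> turns them into the premises on \<open>s \<otimes> s\<close>
    and \<open>s \<otimes> r \<otimes> inv s\<close>.\<close>
  have rels: "word_cong ?R `` {[Gen Reflection, Gen Reflection]} = word_cong ?R `` {[]}"
    "word_cong ?R `` {[Gen Reflection, Gen Rotation, Gen_inv Reflection]} =
      word_cong ?R `` {[Gen_inv Rotation]}"
    by (intro presented_group_class_eq word_cong.relation; simp add: dihedral_relations_def)+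
  show ?thesis
    using presented_group_generate[of ?R] rels unfolding gens
    by (intro good_group_dihedral[of "word_cong ?R `` {[Gen Reflection]}"
          "word_cong ?R `` {[Gen Rotation]}"])
      (simp_all add: dihedral_group_def presented_group_mult presented_group_one
        presented_group_inv_Gen presented_group_class_closed)
qed

end
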